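(* Let $K\subset L$ be fields and let $T=K+XL[X]$ be Noetherian. Assume that $|G(L\mid K)|=[L\colon K]$ and that for every field $M$ such that $L\subset M$, every $K$-isomorphism $\varphi\colon M\to M$ satisfies $\varphi(L)=L$. Then $T$ is Noetherian if and only if $K\subset L$ is a Galois extension.
   Context: Rings are commutative with unity. $K+XL[X]$ denotes the polynomial composite, i.e. the subring of $L[X]$ consisting of the polynomials whose constant term lies in $K$. $G(L\mid K)$ denotes the group $\mathrm{Aut}_K L$ of field automorphisms of $L$ fixing $K$ pointwise; $[L\colon K]$ is the degree of the extension. A $K$-isomorphism is a field isomorphism fixing $K$ pointwise. An extension $K\subset L$ is Galois if it is algebraic, separable (minimal polynomials over $K$ of elements of $L$ have no repeated roots in an algebraic closure of $K$) and normal (every irreducible polynomial in $K[X]$ that has a root in $L$ factors completely into linear factors over $L$). *)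

theory Defs
  imports "HOL-Algebra.Algebra" "HOL-Library.Equipollence"
begin

text \<open>
  Throughout, \<open>L\<close> is a field and \<open>K\<close> is the carrier of a subfield of \<open>L\<close>.
\<close>

definition poly_composite :: "('a, 'b) ring_scheme \<Rightarrow> 'a set \<Rightarrow> 'a list ring" where
  "poly_composite L K =
     (poly_ring L) \<lparr>carrier := {p \<in> carrier (poly_ring L). ring.const_term L p \<in> K}\<rparr>"

text \<open>
  Automorphisms are taken to be extensional on the carrier, as in \<^const>\<open>AutoGroup\<close>, so that
  functions differing only outside \<open>L\<close> are not counted separately.
\<close>

definition galois_group :: "('a, 'b) ring_scheme \<Rightarrow> 'a set \<Rightarrow> ('a \<Rightarrow> 'a) monoid" where
  "galois_group L K =
     BijGroup (carrier L)
       \<lparr>carrier := {f \<in> ring_iso L L \<inter> extensional (carrier L). \<forall>x\<in>K. f x = x}\<rparr>"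

text \<open>
  A possibly infinite basis of \<open>L\<close> as a \<open>K\<close>-vector space: \<^const>\<open>ring.dim\<close> is only meaningful
  in the finite-dimensional case. The degree of the extension is the cardinality of any basis.
\<close>

definition vs_basis :: "('a, 'b) ring_scheme \<Rightarrow> 'a set \<Rightarrow> 'a set \<Rightarrow> bool" where
  "vs_basis L K B \<longleftrightarrow>
     B \<subseteq> carrier L \<and>
     (\<forall>Us. distinct Us \<and> set Us \<subseteq> B \<longrightarrow> ring.independent L K Us) \<and>
     (\<forall>x\<in>carrier L. \<exists>Us. set Us \<subseteq> B \<and> x \<in> ring.Span L K Us)"

text \<open>\<open>|A| = [L : K]\<close> as an equality of cardinals.\<close>

definition card_eq_degree :: "'c set \<Rightarrow> ('a, 'b) ring_scheme \<Rightarrow> 'a set \<Rightarrow> bool" where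
  "card_eq_degree A L K \<longleftrightarrow> (\<exists>B. vs_basis L K B \<and> A \<approx> B)"

definition algebraic_extension :: "('a, 'b) ring_scheme \<Rightarrow> 'a set \<Rightarrow> bool" where
  "algebraic_extension L K \<longleftrightarrow> (\<forall>x\<in>carrier L. (ring.algebraic L over K) x)"

text \<open>
  The algebraic closure of \<open>K\<close> is a field on a different type; \<^const>\<open>ring.indexed_const\<close> is the
  embedding of \<open>K\<close> into it and \<^const>\<open>ring.\<sigma>\<close> is the induced map on polynomials.
\<close>

definition separable_extension :: "('a, 'b) ring_scheme \<Rightarrow> 'a set \<Rightarrow> bool" where
  "separable_extension L K \<longleftrightarrow>
     (let F = L\<lparr>carrier := K\<rparr>; C = field.alg_closure F in
      \<forall>x\<in>carrier L. \<forall>a\<in>carrier C.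
        ring.alg_mult C (ring.\<sigma> F (ring.Irr L K x)) a \<le> 1)"

definition normal_extension :: "('a, 'b) ring_scheme \<Rightarrow> 'a set \<Rightarrow> bool" where
  "normal_extension L K \<longleftrightarrow>
     (\<forall>p\<in>carrier (K[X]\<^bsub>L\<^esub>).
        pirreducible\<^bsub>L\<^esub> K p \<and> (\<exists>x\<in>carrier L. ring.is_root L p x) \<longrightarrow> ring.splitted L p)"

definition galois_extension :: "('a, 'b) ring_scheme \<Rightarrow> 'a set \<Rightarrow> bool" where
  "galois_extension L K \<longleftrightarrow>
     algebraic_extension L K \<and> separable_extension L K \<and> normal_extension L K"

text \<open>
  Every \<open>K\<close>-isomorphism \<open>M \<rightarrow> M\<close> maps \<open>L\<close> onto itself. An inclusion of \<open>L\<close> in \<open>M\<close> is a (necessarily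
  injective) homomorphism \<open>h\<close>, because the elements of \<open>M\<close> may have another type.
\<close>

definition invariant_in ::
  "('a, 'b) ring_scheme \<Rightarrow> 'a set \<Rightarrow> ('m, 'c) ring_scheme \<Rightarrow> bool" where
  "invariant_in L K M \<longleftrightarrow>
     (\<forall>h\<in>ring_hom L M. \<forall>\<phi>\<in>ring_iso M M.
        (\<forall>x\<in>K. \<phi> (h x) = h x) \<longrightarrow> \<phi> ` h ` carrier L = h ` carrier L)"

text \<open>
  A formula cannot quantify over the fields \<open>M\<close> on all types. It suffices, however, to consider
  the fields on one type: the lemma \<open>invariant_in_universal\<close> below shows that if \<open>L\<close> is invariant
  in every field on the type \<open>('a + nat) list\<close>, then it is invariant in every field on every type.
  The reason is that a counterexample \<open>\<phi>\<close> on \<open>N\<close> restricts to the subfield of \<open>N\<close> generated by \<open>L\<close>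
  and closed under \<open>\<phi>\<close> and its inverse, whose elements are denoted by programs in reverse Polish
  notation over the alphabet \<open>'a + nat\<close>.
\<close>

inductive_set aut_closure :: "('n, 'c) ring_scheme \<Rightarrow> 'n set \<Rightarrow> ('n \<Rightarrow> 'n) \<Rightarrow> ('n \<Rightarrow> 'n) \<Rightarrow> 'n set"
  for N (structure) and A and \<phi> and \<psi> where
  base: "a \<in> A \<Longrightarrow> a \<in> aut_closure N A \<phi> \<psi>"
| one: "\<one> \<in> aut_closure N A \<phi> \<psi>"
| add: "x \<in> aut_closure N A \<phi> \<psi> \<Longrightarrow> y \<in> aut_closure N A \<phi> \<psi> \<Longrightarrow> x \<oplus> y \<in> aut_closure N A \<phi> \<psi>"
| mult: "x \<in> aut_closure N A \<phi> \<psi> \<Longrightarrow> y \<in> aut_closure N A \<phi> \<psi> \<Longrightarrow> x \<otimes> y \<in> aut_closure N A \<phi> \<psi>"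
| neg: "x \<in> aut_closure N A \<phi> \<psi> \<Longrightarrow> \<ominus> x \<in> aut_closure N A \<phi> \<psi>"
| inverse: "x \<in> aut_closure N A \<phi> \<psi> \<Longrightarrow> x \<noteq> \<zero> \<Longrightarrow> inv x \<in> aut_closure N A \<phi> \<psi>"
| fwd: "x \<in> aut_closure N A \<phi> \<psi> \<Longrightarrow> \<phi> x \<in> aut_closure N A \<phi> \<psi>"
| bwd: "x \<in> aut_closure N A \<phi> \<psi> \<Longrightarrow> \<psi> x \<in> aut_closure N A \<phi> \<psi>"

fun rpn_step :: "('n, 'c) ring_scheme \<Rightarrow> ('a \<Rightarrow> 'n) \<Rightarrow> ('n \<Rightarrow> 'n) \<Rightarrow> ('n \<Rightarrow> 'n) \<Rightarrow>
    'a + nat \<Rightarrow> 'n list \<Rightarrow> 'n list" where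
  "rpn_step N h \<phi> \<psi> (Inl a) st = h a # st"
| "rpn_step N h \<phi> \<psi> (Inr k) st =
     (if k = 0 then \<one>\<^bsub>N\<^esub> # st
      else if k = 1 then (hd st \<oplus>\<^bsub>N\<^esub> hd (tl st)) # tl (tl st)
      else if k = 2 then (hd st \<otimes>\<^bsub>N\<^esub> hd (tl st)) # tl (tl st)
      else if k = 3 then (\<ominus>\<^bsub>N\<^esub> hd st) # tl st
      else if k = 4 then (inv\<^bsub>N\<^esub> hd st) # tl st
      else if k = 5 then \<phi> (hd st) # tl st
      else \<psi> (hd st) # tl st)"

lemma aut_closure_rpn:
  assumes "x \<in> aut_closure N (h ` A) \<phi> \<psi>"
  shows "\<exists>w. \<forall>st. fold (rpn_step N h \<phi> \<psi>) w st = x # st"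
  using assms
proof induction
  case (base a)
  then obtain b where "a = h b" by blast
  then have "\<forall>st. fold (rpn_step N h \<phi> \<psi>) [Inl b] st = a # st" by simp
  then show ?case by blast
next
  case one
  have "\<forall>st. fold (rpn_step N h \<phi> \<psi>) [Inr 0] st = \<one>\<^bsub>N\<^esub> # st" by simp
  then show ?case by blast
next
  case (add x y)
  then obtain v w where "\<forall>st. fold (rpn_step N h \<phi> \<psi>) v st = x # st"
    "\<forall>st. fold (rpn_step N h \<phi> \<psi>) w st = y # st" by blast
  then have "\<forall>st. fold (rpn_step N h \<phi> \<psi>) (w @ v @ [Inr 1]) st = (x \<oplus>\<^bsub>N\<^esub> y) # st" by simp
  then show ?case by blast
next
  case (mult x y)
  then obtain v w where "\<forall>st. fold (rpn_step N h \<phi> \<psi>) v st = x # st"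
    "\<forall>st. fold (rpn_step N h \<phi> \<psi>) w st = y # st" by blast
  then have "\<forall>st. fold (rpn_step N h \<phi> \<psi>) (w @ v @ [Inr 2]) st = (x \<otimes>\<^bsub>N\<^esub> y) # st" by simp
  then show ?case by blast
next
  case (neg x)
  then obtain v where "\<forall>st. fold (rpn_step N h \<phi> \<psi>) v st = x # st" by blast
  then have "\<forall>st. fold (rpn_step N h \<phi> \<psi>) (v @ [Inr 3]) st = (\<ominus>\<^bsub>N\<^esub> x) # st" by simp
  then show ?case by blast
next
  case (inverse x)
  then obtain v where "\<forall>st. fold (rpn_step N h \<phi> \<psi>) v st = x # st" by blast
  then have "\<forall>st. fold (rpn_step N h \<phi> \<psi>) (v @ [Inr 4]) st = (inv\<^bsub>N\<^esub> x) # st" by simp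
  then show ?case by blast
next
  case (fwd x)
  then obtain v where "\<forall>st. fold (rpn_step N h \<phi> \<psi>) v st = x # st" by blast
  then have "\<forall>st. fold (rpn_step N h \<phi> \<psi>) (v @ [Inr 5]) st = \<phi> x # st" by simp
  then show ?case by blast
next
  case (bwd x)
  then obtain v where "\<forall>st. fold (rpn_step N h \<phi> \<psi>) v st = x # st" by blast
  then have "\<forall>st. fold (rpn_step N h \<phi> \<psi>) (v @ [Inr 6]) st = \<psi> x # st" by simp
  then show ?case by blast
qed

lemma invariant_in_universal:
  fixes L :: "('a, 'b) ring_scheme" and N :: "('n, 'c) ring_scheme"
  assumes inv: "\<And>M :: ('a + nat) list ring. field M \<Longrightarrow> invariant_in L K M"
    and N: "field N" and K: "K \<subseteq> carrier L"
  shows "invariant_in L K N"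
  unfolding invariant_in_def
proof (intro ballI impI)
  fix h \<phi> assume h: "h \<in> ring_hom L N" and \<phi>: "\<phi> \<in> ring_iso N N"
    and fixK: "\<forall>x\<in>K. \<phi> (h x) = h x"
  interpret N: field N by (rule N)
  define \<psi> where "\<psi> = inv_into (carrier N) \<phi>"
  define S where "S = aut_closure N (h ` carrier L) \<phi> \<psi>"
  have bij: "bij_betw \<phi> (carrier N) (carrier N)" and hom: "\<phi> \<in> ring_hom N N"
    using \<phi> by (auto simp: ring_iso_def)
  have \<psi>_closed: "\<psi> x \<in> carrier N" and \<phi>_\<psi>: "\<phi> (\<psi> x) = x" if "x \<in> carrier N" for x
    using that bij unfolding \<psi>_def
    by (metis bij_betw_imp_surj_on inv_into_into, metis bij_betw_inv_into_right)
  have hL: "h ` carrier L \<subseteq> carrier N" using h by (auto simp: ring_hom_def)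
  have S_carr: "x \<in> carrier N" if "x \<in> S" for x
    using that unfolding S_def
  proof induction
    case (inverse x)
    then show ?case using N.field_Units by auto
  qed (use hL hom \<psi>_closed in \<open>auto simp: ring_hom_closed\<close>)
  have sub: "subfield S N"
  proof (rule N.subfieldI')
    show "subring S N"
      by (rule N.subringI) (use S_carr in \<open>auto simp: S_def intro: aut_closure.intros\<close>)
  qed (auto simp: S_def intro: aut_closure.intros)
  define F where "F = N\<lparr>carrier := S\<rparr>"
  have F: "field F" unfolding F_def using N.subfield_iff(2)[OF sub] .
  have carrF: "carrier F = S" by (simp add: F_def)
  define c where "c = (\<lambda>x. SOME w. \<forall>st. fold (rpn_step N h \<phi> \<psi>) w st = x # st)"
  have c: "\<forall>st. fold (rpn_step N h \<phi> \<psi>) (c x) st = x # st" if "x \<in> S" for x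
    unfolding c_def by (rule someI_ex) (use aut_closure_rpn that S_def in fast)
  have injc: "inj_on c S"
    by (rule inj_onI) (metis c list.inject)
  define M where "M = image_ring c F"
  have M: "field M" unfolding M_def
    by (rule field.inj_imp_image_ring_is_field[OF F]) (simp add: carrF injc)
  have c_iso: "c \<in> ring_iso F M" unfolding M_def
    by (rule inj_imp_image_ring_iso) (simp add: carrF injc)
  then have c_hom: "c \<in> ring_hom F M" by (simp add: ring_iso_def)
  define d where "d = inv_into (carrier F) c"
  have d_iso: "d \<in> ring_iso M F"
    unfolding d_def by (rule ring_iso_set_sym[OF _ c_iso]) (rule F[THEN field.is_ring])
  have dc: "d (c x) = x" if "x \<in> S" for x
    unfolding d_def using that injc by (simp add: carrF)
  have \<phi>S: "\<phi> \<in> ring_iso F F"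
  proof (rule ring_iso_memI)
    show "bij_betw \<phi> (carrier F) (carrier F)"
      unfolding carrF
    proof (rule bij_betwI')
      fix x y assume "x \<in> S" "y \<in> S"
      then show "\<phi> x = \<phi> y \<longleftrightarrow> x = y"
        using bij S_carr by (metis bij_betw_inv_into_left)
    next
      fix y assume "y \<in> S"
      then show "\<exists>x\<in>S. y = \<phi> x"
        using S_carr \<phi>_\<psi> by (metis S_def aut_closure.bwd)
    qed (auto simp: S_def intro: aut_closure.intros)
  qed (use S_carr hom in \<open>auto simp: F_def ring_hom_mult ring_hom_add ring_hom_one S_def
         intro: aut_closure.intros\<close>)
  have hF: "h \<in> ring_hom L F"
    using h unfolding ring_hom_def F_def S_def by (auto intro: aut_closure.base)
  have hS: "h x \<in> S" if "x \<in> carrier L" for x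
    using that by (auto simp: S_def intro: aut_closure.base)
  have ch: "c \<circ> h \<in> ring_hom L M" using ring_hom_trans[OF hF c_hom] .
  have \<phi>': "c \<circ> (\<phi> \<circ> d) \<in> ring_iso M M"
    using ring_iso_set_trans[OF ring_iso_set_trans[OF d_iso \<phi>S] c_iso] by (simp add: comp_assoc)
  show "\<phi> ` h ` carrier L = h ` carrier L"
  proof -
    have "\<forall>x\<in>K. (c \<circ> (\<phi> \<circ> d)) ((c \<circ> h) x) = (c \<circ> h) x"
      using K fixK hS dc by (auto simp: subset_iff)
    then have "(c \<circ> (\<phi> \<circ> d)) ` (c \<circ> h) ` carrier L = (c \<circ> h) ` carrier L"
      using inv[OF M] ch \<phi>' unfolding invariant_in_def by blast
    moreover have "(c \<circ> (\<phi> \<circ> d)) ` (c \<circ> h) ` carrier L = c ` \<phi> ` h ` carrier L"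
      unfolding image_image by (rule image_cong) (use hS dc in auto)
    moreover have "(c \<circ> h) ` carrier L = c ` h ` carrier L"
      by (simp add: image_comp)
    moreover have "\<phi> ` h ` carrier L \<subseteq> S" and "h ` carrier L \<subseteq> S"
      using hS by (auto simp: S_def intro: aut_closure.fwd)
    ultimately show ?thesis
      using inj_on_image_eq_iff[OF injc] by metis
  qed
qed

end

theory Submission
  imports Defs
begin

text \<open>
  A Noetherian \<open>K + XL[X]\<close> forces \<open>n = [L : K]\<close> to be finite, because finitely many generators of its
  ideal \<open>XL[X]\<close> have linear coefficients that span \<open>L\<close> over \<open>K\<close>
  (\<open>noetherian_composite_imp_finite_dimension\<close>). So \<open>G(L | K)\<close> is a finite group with exactly \<open>n\<close>
  elements, and \<open>L\<close> is algebraic over \<open>K\<close>.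

  That many automorphisms produce as many roots as possible. Let \<open>p\<close> be irreducible over \<open>K\<close> with a
  root \<open>x\<close> in \<open>L\<close>, and let \<open>E = K(x)\<close>. Automorphisms that send \<open>x\<close> to the same root of \<open>p\<close> agree on
  \<open>E\<close>, and by Dedekind's independence of homomorphisms at most \<open>[L : E]\<close> automorphisms agree on \<open>E\<close>
  (\<open>card_homs_agreeing_le_degree\<close>). Since \<open>n = deg p * [L : E]\<close>, the polynomial \<open>p\<close> has at least \<open>deg p\<close>
  roots in \<open>L\<close> (\<open>degree_le_card_roots\<close>). Thus \<open>p\<close> splits in \<open>L\<close> with simple roots.

  Splitting is normality. Separability asks for simple roots in the algebraic closure of \<open>K\<close> instead
  of \<open>L\<close>. For an irreducible polynomial both amount to the formal derivative being nonzero
  (\<open>simple_root_iff_formal_deriv_nonzero\<close>).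
\<close>

section \<open>Finiteness of the degree\<close>

lemma (in cring) coeff_0_eq_const_term:
  "set p \<subseteq> carrier R \<Longrightarrow> coeff p 0 = const_term p"
  by (cases p rule: rev_cases) (auto simp: append_coeff const_term_eq_last const_term_def[of "[]"])

lemma (in cring) coeff_1_poly_mult:
  assumes "set p \<subseteq> carrier R" "set q \<subseteq> carrier R"
  shows "coeff (poly_mult p q) 1
    = coeff p 0 \<otimes> coeff q 1 \<oplus> coeff p 1 \<otimes> coeff q 0"
proof -
  have "{..1::nat} = insert 1 {0}" by auto
  moreover have "(\<Oplus>k\<in>insert (1::nat) {0}. coeff p k \<otimes> coeff q (1 - k))
      = coeff p 1 \<otimes> coeff q 0 \<oplus> coeff p 0 \<otimes> coeff q 1"
    using assms by (subst finsum_insert) (auto simp: coeff_in_carrier)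
  ultimately show ?thesis
    using assms by (simp add: poly_mult_coeff a_comm coeff_in_carrier del: poly_mult.simps)
qed

text \<open>
  The ideal \<open>XL[X]\<close> of \<open>K + XL[X]\<close> has finitely many generators \<open>f\<close>. Multiplying an
  element of \<open>XL[X]\<close> by \<open>g\<close> scales its coefficient of \<open>X\<close> by the constant term of \<open>g\<close>, which lies in
  \<open>K\<close>. So the linear coefficients of the elements of \<open>XL[X]\<close>, which are all the elements of \<open>L\<close>, are
  \<open>K\<close>-combinations of those of the generators.
\<close>

lemma (in field) noetherian_composite_imp_finite_dimension:
  assumes K: "subfield K R" and T: "noetherian_ring (poly_composite R K)"
  shows "finite_dimension K (carrier R)"
proof -
  note [simp del] = poly_add.simps poly_mult.simps
  let ?T = "poly_composite R K"
  interpret T: noetherian_ring ?T by (rule T)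
  have ops: "monoid.mult ?T = poly_mult" "add ?T = poly_add" "\<zero>\<^bsub>?T\<^esub> = []" "\<one>\<^bsub>?T\<^esub> = [\<one>]"
    by (simp_all add: poly_composite_def univ_poly_mult univ_poly_add univ_poly_zero univ_poly_one)
  have carrT: "p \<in> carrier ?T \<longleftrightarrow> p \<in> carrier (poly_ring R) \<and> const_term p \<in> K" for p
    by (simp add: poly_composite_def)
  have sT: "set p \<subseteq> carrier R" if "p \<in> carrier ?T" for p
    using that by (auto simp: carrT polynomial_def simp flip: univ_poly_carrier)
  have "ring_hom_ring ?T R const_term"
  proof (rule ring_hom_ringI)
    show "const_term \<one>\<^bsub>?T\<^esub> = \<one>" by (simp add: ops const_term_def)
  qed (simp_all add: T.ring_axioms ring_axioms sT ops const_term_simprules)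
  define I where "I = a_kernel ?T R const_term"
  have I_iff: "p \<in> I \<longleftrightarrow> p \<in> carrier ?T \<and> const_term p = \<zero>" for p by (simp add: I_def a_kernel_def')
  have I: "ideal I ?T"
    unfolding I_def by (rule ring_hom_ring.kernel_is_ideal) fact
  then interpret I: ideal I ?T .
  obtain A where A: "A \<subseteq> carrier ?T" "finite A" "I = Idl\<^bsub>?T\<^esub> A"
    using T.finetely_gen[OF I] by blast
  obtain Us where Us: "set Us = (\<lambda>p. coeff p 1) ` A"
    using finite_list[OF finite_imageI[OF A(2)]] by metis
  have Us_carr: "set Us \<subseteq> carrier R" unfolding Us using A(1) sT by (auto simp: coeff_in_carrier)
  note W = Span_subgroup_props[OF K Us_carr] Span_smult_closed[OF K Us_carr]
  \<comment> \<open>\<open>J\<close> is an ideal that contains the generators of \<open>I\<close>, hence all of \<open>I\<close>.\<close>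
  define J where "J = {p \<in> I. coeff p 1 \<in> Span K Us}"
  have "ideal J ?T"
  proof (rule idealI)
    show "subgroup J (add_monoid ?T)"
    proof (rule T.add.subgroupI)
      show "J \<subseteq> carrier ?T" using I.Icarr by (auto simp: J_def)
      show "J \<noteq> {}" using I.zero_closed W(2) by (auto simp: J_def ops)
      fix p assume p: "p \<in> J"
      then have pI: "p \<in> I" and cp: "coeff p 1 \<in> Span K Us" by (auto simp: J_def)
      have pT: "p \<in> carrier ?T" "\<ominus>\<^bsub>?T\<^esub> p \<in> carrier ?T" using I.Icarr[OF pI] by auto
      have "poly_add (\<ominus>\<^bsub>?T\<^esub> p) p = []" using T.l_neg[OF pT(1)] by (simp add: ops)
      then have "coeff (\<ominus>\<^bsub>?T\<^esub> p) 1 \<oplus> coeff p 1 = \<zero>"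
        using poly_add_coeff[OF sT[OF pT(2)] sT[OF pT(1)]] by (metis coeff.simps(1))
      then have "coeff (\<ominus>\<^bsub>?T\<^esub> p) 1 = \<ominus> coeff p 1"
        by (rule sum_zero_eq_neg[rotated 2]) (use coeff_in_carrier sT pT in auto)
      then show "\<ominus>\<^bsub>?T\<^esub> p \<in> J" using I.a_inv_closed[OF pI] cp W(4) by (simp add: J_def)
      fix q assume q: "q \<in> J"
      then have qI: "q \<in> I" and cq: "coeff q 1 \<in> Span K Us" by (auto simp: J_def)
      have "coeff (p \<oplus>\<^bsub>?T\<^esub> q) 1 = coeff p 1 \<oplus> coeff q 1"
        unfolding ops using poly_add_coeff[OF sT[OF pT(1)] sT[OF I.Icarr[OF qI]]] by simp
      then show "p \<oplus>\<^bsub>?T\<^esub> q \<in> J"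
        using I.a_closed[OF pI qI] W(3)[OF cp cq] by (simp add: J_def)
    qed
  next
    fix p f assume p: "p \<in> J" and f: "f \<in> carrier ?T"
    then have pI: "p \<in> I" and cp: "coeff p 1 \<in> Span K Us" by (auto simp: J_def)
    have sp: "set p \<subseteq> carrier R" and sf: "set f \<subseteq> carrier R" using sT I.Icarr[OF pI] f by auto
    have p0: "coeff p 0 = \<zero>" and f0: "coeff f 0 \<in> K"
      using pI f coeff_0_eq_const_term sp sf by (auto simp: I_iff carrT)
    have f0c: "coeff f 0 \<in> carrier R" "coeff f 1 \<in> carrier R" "coeff p 1 \<in> carrier R"
      using coeff_in_carrier sp sf by auto
    have "coeff (f \<otimes>\<^bsub>?T\<^esub> p) 1 = coeff f 0 \<otimes> coeff p 1"
      unfolding ops coeff_1_poly_mult[OF sf sp] using p0 f0c by simp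
    then show "f \<otimes>\<^bsub>?T\<^esub> p \<in> J"
      using W(5)[OF f0 cp] I.I_l_closed[OF pI f] by (simp add: J_def)
    have "coeff (p \<otimes>\<^bsub>?T\<^esub> f) 1 = coeff f 0 \<otimes> coeff p 1"
      unfolding ops coeff_1_poly_mult[OF sp sf] using p0 f0c by (simp add: m_comm)
    then show "p \<otimes>\<^bsub>?T\<^esub> f \<in> J"
      using W(5)[OF f0 cp] I.I_r_closed[OF pI f] by (simp add: J_def)
  qed (rule T.ring_axioms)
  moreover have "A \<subseteq> J"
    using T.genideal_self[OF A(1)] A(3) Us Span_base_incl[OF K Us_carr] by (auto simp: J_def)
  ultimately have IJ: "I \<subseteq> J" unfolding A(3) by (rule T.genideal_minimal)
  have "carrier R \<subseteq> Span K Us"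
  proof
    fix l assume l: "l \<in> carrier R"
    show "l \<in> Span K Us"
    proof (cases "l = \<zero>")
      case True
      then show ?thesis using W(2) by simp
    next
      case False
      \<comment> \<open>The polynomial \<open>l X\<close> is an element of \<open>I\<close> with linear coefficient \<open>l\<close>.\<close>
      have "const_term [l, \<zero>] = \<zero>" using l by (simp add: const_term_def)
      moreover have "[l, \<zero>] \<in> carrier (poly_ring R)"
        using l False by (simp add: polynomial_def flip: univ_poly_carrier)
      ultimately have "[l, \<zero>] \<in> I"
        using subringE(2)[OF subfieldE(1)[OF K]] by (simp add: I_iff carrT)
      then have "coeff [l, \<zero>] 1 \<in> Span K Us" using IJ unfolding J_def by blast
      moreover have "coeff [l, \<zero>] 1 = l" by simp
      ultimately show ?thesis by metis
    qed
  qed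
  then have "Span K Us = carrier R" using W(1) by blast
  then show ?thesis using Span_finite_dimension[OF K Us_carr] by simp
qed

text \<open>
  Independent lists in a space of dimension \<open>n\<close> have length at most \<open>n\<close>, so \<open>B\<close> is finite and
  can be listed as a basis.
\<close>

lemma (in field) card_vs_basis:
  assumes K: "subfield K R" and dim: "dimension n K (carrier R)" and B: "vs_basis R K B"
  shows "finite B" "card B = n"
proof -
  have Bc: "B \<subseteq> carrier R" and ind: "\<And>Us. distinct Us \<Longrightarrow> set Us \<subseteq> B \<Longrightarrow> independent K Us"
    and span: "\<And>x. x \<in> carrier R \<Longrightarrow> \<exists>Us. set Us \<subseteq> B \<and> x \<in> Span K Us"
    using B by (auto simp: vs_basis_def)
  have bound: "length Us \<le> n" if "distinct Us" "set Us \<subseteq> B" for Us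
    using independent_length_le_dimension[OF K dim ind[OF that]] that Bc by blast
  show fin: "finite B"
  proof (rule ccontr)
    assume "infinite B"
    then obtain Y where Y: "Y \<subseteq> B" "finite Y" "card Y = Suc n"
      using infinite_arbitrarily_large by blast
    then show False
      using bound finite_distinct_list[OF Y(2)] Y distinct_card by fastforce
  qed
  obtain Us where Us: "distinct Us" "set Us = B" using finite_distinct_list[OF fin] by blast
  have "carrier R \<subseteq> Span K Us"
  proof
    fix x assume "x \<in> carrier R"
    then obtain Vs where Vs: "set Vs \<subseteq> B" "x \<in> Span K Vs" using span by blast
    have "Span K Vs \<subseteq> Span K Us"
      using mono_Span_subset[OF K, of Vs Us] Span_base_incl[OF K, of Us] Vs(1) Us Bc by blast
    then show "x \<in> Span K Us" using Vs(2) by blast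
  qed
  then have "Span K Us = carrier R" using Span_in_carrier[of K Us] Us Bc subfieldE(3)[OF K] by blast
  then have "length Us = n"
    using dimension_is_inj[OF K dim] dimensionI[OF K ind] Us by blast
  then show "card B = n" using Us distinct_card by blast
qed

section \<open>Independence of homomorphisms\<close>

text \<open>
  Gaussian elimination, with \<open>S\<close> indexing the unknowns and \<open>U\<close> the equations: an equation with
  a nonzero coefficient at \<open>t\<close> is used to remove the unknown \<open>t\<close> from the others, which leaves one
  equation and one unknown fewer.
\<close>

lemma (in field) exists_nontrivial_solution:
  assumes "finite U" "finite S" "card U < card S"
    and "\<And>s u. s \<in> S \<Longrightarrow> u \<in> U \<Longrightarrow> a s u \<in> carrier R"
  shows "\<exists>c. c \<in> S \<rightarrow> carrier R \<and> (\<exists>s\<in>S. c s \<noteq> \<zero>) \<and> (\<forall>u\<in>U. (\<Oplus>s\<in>S. c s \<otimes> a s u) = \<zero>)"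
  using assms
proof (induction U arbitrary: S a rule: finite_induct)
  case empty
  then obtain s where "s \<in> S" by fastforce
  then show ?case by (intro exI[of _ "\<lambda>_. \<one>"]) auto
next
  case (insert u U)
  show ?case
  proof (cases "\<forall>s\<in>S. a s u = \<zero>")
    case True
    from insert.IH[of S a] insert.prems insert.hyps
    obtain c where c: "c \<in> S \<rightarrow> carrier R" "\<exists>s\<in>S. c s \<noteq> \<zero>"
      "\<forall>v\<in>U. (\<Oplus>s\<in>S. c s \<otimes> a s v) = \<zero>" by auto
    have "(\<Oplus>s\<in>S. c s \<otimes> a s u) = (\<Oplus>s\<in>S. \<zero>)"
      by (rule finsum_cong') (use True c in \<open>auto simp: Pi_def\<close>)
    then show ?thesis using c by (intro exI[of _ c]) auto
  next
    case False
    then obtain t where t: "t \<in> S" "a t u \<noteq> \<zero>" by blast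
    define S' where "S' = S - {t}"
    define w where "w = inv (a t u)"
    have at: "a t u \<in> carrier R" using insert.prems t by auto
    have w: "w \<in> carrier R" "w \<otimes> a t u = \<one>"
      unfolding w_def using at t(2) field_Units by auto
    have S: "S = insert t S'" "t \<notin> S'" "finite S'" and fin: "finite S"
      using t insert.prems by (auto simp: S'_def)
    have ac: "a s v \<in> carrier R" if "s \<in> S" "v \<in> insert u U" for s v
      using insert.prems that by auto
    \<comment> \<open>The system on \<open>S'\<close> after elimination of \<open>t\<close> with the equation \<open>u\<close>.\<close>
    define b where "b = (\<lambda>s v. a s v \<oplus> a s u \<otimes> (\<ominus> (w \<otimes> a t v)))"
    have "card U < card S'" using insert.prems(2) insert.hyps S by simp
    moreover have "b s v \<in> carrier R" if "s \<in> S'" "v \<in> U" for s v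
      unfolding b_def using ac that w S t by simp
    ultimately obtain c where c: "c \<in> S' \<rightarrow> carrier R" "\<exists>s\<in>S'. c s \<noteq> \<zero>"
      "\<forall>v\<in>U. (\<Oplus>s\<in>S'. c s \<otimes> b s v) = \<zero>"
      using insert.IH[of S' b] S by blast
    define \<Sigma> where "\<Sigma> = (\<lambda>v. \<Oplus>s\<in>S'. c s \<otimes> a s v)"
    have \<Sigma>: "\<Sigma> v \<in> carrier R" if "v \<in> insert u U" for v
      unfolding \<Sigma>_def by (rule finsum_closed) (use ac c that S in auto)
    define c' where "c' = c(t := \<ominus> (\<Sigma> u \<otimes> w))"
    have split: "(\<Oplus>s\<in>S. c' s \<otimes> a s v) = \<ominus> (\<Sigma> u \<otimes> w) \<otimes> a t v \<oplus> \<Sigma> v" if v: "v \<in> insert u U" for v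
    proof -
      have "(\<Oplus>s\<in>S'. c' s \<otimes> a s v) = \<Sigma> v"
        unfolding \<Sigma>_def by (rule finsum_cong') (use ac c(1) v S in \<open>auto simp: c'_def\<close>)
      moreover have "(\<lambda>s. c' s \<otimes> a s v) \<in> S' \<rightarrow> carrier R"
        using ac c(1) v S by (auto simp: c'_def Pi_iff)
      moreover have "c' t \<otimes> a t v \<in> carrier R" using \<Sigma> w ac v t by (auto simp: c'_def)
      ultimately show ?thesis using finsum_insert[of S' t] S by (simp add: c'_def)
    qed
    have "(\<Oplus>s\<in>S. c' s \<otimes> a s v) = \<zero>" if v: "v \<in> insert u U" for v
    proof (cases "v = u")
      case True
      have "\<ominus> (\<Sigma> u \<otimes> w) \<otimes> a t u = \<ominus> \<Sigma> u"
        using \<Sigma>[of u] w at by (simp add: l_minus m_assoc)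
      then show ?thesis using True split[of u] \<Sigma>[of u] by (simp add: l_neg)
    next
      case False
      with v have vU: "v \<in> U" by simp
      have "(\<Oplus>s\<in>S'. c s \<otimes> b s v) = (\<Oplus>s\<in>S'. c s \<otimes> a s v \<oplus> (c s \<otimes> a s u) \<otimes> (\<ominus> (w \<otimes> a t v)))"
      proof (rule finsum_cong')
        fix s assume s: "s \<in> S'"
        have "c s \<in> carrier R" "a s v \<in> carrier R" "a s u \<in> carrier R" "\<ominus> (w \<otimes> a t v) \<in> carrier R"
          using c s S ac v w t by auto
        then show "c s \<otimes> b s v = c s \<otimes> a s v \<oplus> (c s \<otimes> a s u) \<otimes> (\<ominus> (w \<otimes> a t v))"
          unfolding b_def by (simp add: r_distr m_assoc)
      qed (use c(1) S ac v w t in \<open>auto simp: Pi_iff\<close>)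
      also have "\<dots> = \<Sigma> v \<oplus> (\<Oplus>s\<in>S'. (c s \<otimes> a s u) \<otimes> (\<ominus> (w \<otimes> a t v)))"
        unfolding \<Sigma>_def by (rule finsum_addf) (use c(1) S ac v w t in \<open>auto simp: Pi_iff\<close>)
      also have "(\<Oplus>s\<in>S'. (c s \<otimes> a s u) \<otimes> (\<ominus> (w \<otimes> a t v))) = \<Sigma> u \<otimes> (\<ominus> (w \<otimes> a t v))"
        unfolding \<Sigma>_def by (rule finsum_ldistr[symmetric]) (use c(1) S ac v w t in \<open>auto simp: Pi_iff\<close>)
      finally have "\<Sigma> v \<oplus> \<Sigma> u \<otimes> (\<ominus> (w \<otimes> a t v)) = \<zero>" using c vU by simp
      moreover have "\<Sigma> u \<otimes> (\<ominus> (w \<otimes> a t v)) = \<ominus> (\<Sigma> u \<otimes> w) \<otimes> a t v"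
        using \<Sigma>[of u] w ac[OF t(1) v] by (simp add: l_minus r_minus m_assoc)
      ultimately show ?thesis
        using split[OF v] a_comm[of "\<Sigma> v"] \<Sigma>[of u] \<Sigma>[OF v] w ac[OF t(1) v] by simp
    qed
    moreover have "c' \<in> S \<rightarrow> carrier R" using c \<Sigma>[of u] w S by (auto simp: c'_def)
    moreover have "\<exists>s\<in>S. c' s \<noteq> \<zero>" using c(2) S by (auto simp: c'_def)
    ultimately show ?thesis by blast
  qed
qed

text \<open>
  Dedekind's independence of homomorphisms. Replacing \<open>x\<close> by \<open>y x\<close> in a relation and
  subtracting \<open>t y\<close> times the relation eliminates the homomorphism \<open>t\<close> and multiplies the
  coefficient of each other \<open>s\<close> by \<open>s y - t y\<close>, which is nonzero for a suitable \<open>y\<close>. Extensionality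
  ensures that distinct elements of \<open>S\<close> differ on the carrier.
\<close>

lemma (in domain) ring_homs_independent:
  assumes "ring A" "finite S" "S \<subseteq> ring_hom A R \<inter> extensional (carrier A)"
    and "c \<in> S \<rightarrow> carrier R"
    and "\<And>x. x \<in> carrier A \<Longrightarrow> (\<Oplus>s\<in>S. c s \<otimes> s x) = \<zero>"
  shows "\<forall>s\<in>S. c s = \<zero>"
  using assms(2-)
proof (induction S arbitrary: c rule: finite_induct)
  case empty
  then show ?case by simp
next
  case (insert t S)
  interpret A: ring A by (rule assms(1))
  have cl: "s x \<in> carrier R" if "s \<in> insert t S" "x \<in> carrier A" for s x
    using insert.prems(1) that ring_hom_closed by fastforce
  have mult: "s (y \<otimes>\<^bsub>A\<^esub> x) = s y \<otimes> s x" if "s \<in> insert t S" "x \<in> carrier A" "y \<in> carrier A" for s x y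
    using insert.prems(1) that ring_hom_mult by fastforce
  have cc: "c s \<in> carrier R" if "s \<in> insert t S" for s using insert.prems(2) that by auto
  have "\<forall>s\<in>S. c s \<otimes> (s y \<ominus> t y) = \<zero>" if y: "y \<in> carrier A" for y
  proof (rule insert.IH)
    fix x assume x: "x \<in> carrier A"
    define \<Sigma> where "\<Sigma> = (\<lambda>z. \<Oplus>s\<in>S. c s \<otimes> s z)"
    have \<Sigma>: "\<Sigma> z \<in> carrier R" "c t \<otimes> t z \<oplus> \<Sigma> z = \<zero>" if "z \<in> carrier A" for z
    proof -
      show "\<Sigma> z \<in> carrier R" unfolding \<Sigma>_def by (rule finsum_closed) (use cc cl that in auto)
      have "(\<Oplus>s\<in>insert t S. c s \<otimes> s z) = c t \<otimes> t z \<oplus> \<Sigma> z"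
        unfolding \<Sigma>_def by (rule finsum_insert) (use insert.hyps cc cl that in auto)
      then show "c t \<otimes> t z \<oplus> \<Sigma> z = \<zero>" using insert.prems(3) that by simp
    qed
    have "(\<Oplus>s\<in>S. c s \<otimes> (s y \<ominus> t y) \<otimes> s x)
        = (\<Oplus>s\<in>S. c s \<otimes> s (y \<otimes>\<^bsub>A\<^esub> x) \<oplus> (\<ominus> t y) \<otimes> (c s \<otimes> s x))"
    proof (rule finsum_cong')
      fix s assume s: "s \<in> S"
      have "c s \<in> carrier R" "s x \<in> carrier R" "s y \<in> carrier R" "t y \<in> carrier R"
        using cc cl x y s by auto
      then show "c s \<otimes> (s y \<ominus> t y) \<otimes> s x = c s \<otimes> s (y \<otimes>\<^bsub>A\<^esub> x) \<oplus> (\<ominus> t y) \<otimes> (c s \<otimes> s x)"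
        using mult[of s x y] s x y by simp algebra
    qed (use cc cl x y in auto)
    also have "\<dots> = \<Sigma> (y \<otimes>\<^bsub>A\<^esub> x) \<oplus> (\<Oplus>s\<in>S. (\<ominus> t y) \<otimes> (c s \<otimes> s x))"
      unfolding \<Sigma>_def by (rule finsum_addf) (use cc cl x y in auto)
    also have "(\<Oplus>s\<in>S. (\<ominus> t y) \<otimes> (c s \<otimes> s x)) = (\<ominus> t y) \<otimes> \<Sigma> x"
      unfolding \<Sigma>_def by (rule finsum_rdistr[symmetric]) (use insert.hyps cc cl x y in auto)
    also have "\<Sigma> (y \<otimes>\<^bsub>A\<^esub> x) \<oplus> (\<ominus> t y) \<otimes> \<Sigma> x = \<zero>"
    proof -
      have *: "c t \<in> carrier R" "t x \<in> carrier R" "t y \<in> carrier R" using cc cl x y by auto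
      have "\<Sigma> x = \<ominus> (c t \<otimes> t x)"
        using \<Sigma>[OF x] * by (simp add: sum_zero_eq_neg a_comm)
      moreover have "\<Sigma> (y \<otimes>\<^bsub>A\<^esub> x) = \<ominus> (c t \<otimes> (t y \<otimes> t x))"
        using \<Sigma>[OF A.m_closed[OF y x]] * mult[of t x y] x y by (simp add: sum_zero_eq_neg a_comm)
      ultimately show ?thesis using * by simp algebra
    qed
    finally show "(\<Oplus>s\<in>S. c s \<otimes> (s y \<ominus> t y) \<otimes> s x) = \<zero>" .
  qed (use insert.prems cc cl y in auto)
  moreover have "\<exists>y\<in>carrier A. s y \<noteq> t y" if "s \<in> S" for s
    using insert.prems(1) insert.hyps(2) that extensionalityI[of s "carrier A" t] by blast
  ultimately have S0: "\<forall>s\<in>S. c s = \<zero>"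
    using cl cc integral_iff r_right_minus_eq
    by (metis insertCI minus_closed)
  have "(\<Oplus>s\<in>insert t S. c s \<otimes> s \<one>\<^bsub>A\<^esub>) = c t \<otimes> t \<one>\<^bsub>A\<^esub> \<oplus> (\<Oplus>s\<in>S. c s \<otimes> s \<one>\<^bsub>A\<^esub>)"
    by (rule finsum_insert) (use insert.hyps cc cl in auto)
  also have "(\<Oplus>s\<in>S. c s \<otimes> s \<one>\<^bsub>A\<^esub>) = (\<Oplus>s\<in>S. \<zero>)"
    by (rule finsum_cong') (use S0 cl in auto)
  also have "t \<one>\<^bsub>A\<^esub> = \<one>" using insert.prems(1) ring_hom_one by fastforce
  finally have "c t = \<zero>" using insert.prems(3)[of "\<one>\<^bsub>A\<^esub>"] cc by simp
  then show ?case using S0 by simp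
qed

text \<open>
  Artin's bound: if there were more homomorphisms than \<open>m = [L : E]\<close>, some nontrivial
  combination of them would vanish on a basis over \<open>E\<close>. As they agree on \<open>E\<close>, the combination is
  semilinear over \<open>E\<close>, so it would vanish everywhere, against Dedekind's independence.
\<close>

lemma (in field) card_homs_agreeing_le_degree:
  assumes E: "subfield E R" and dim: "dimension m E (carrier R)"
    and S: "finite S" "S \<subseteq> ring_hom R R \<inter> extensional (carrier R)"
    and agree: "\<And>s t k. s \<in> S \<Longrightarrow> t \<in> S \<Longrightarrow> k \<in> E \<Longrightarrow> s k = t k"
  shows "card S \<le> m"
proof (rule ccontr)
  assume "\<not> card S \<le> m"
  obtain Us where Us: "set Us \<subseteq> carrier R" "length Us = m" "Span E Us = carrier R"
    using exists_base[OF E dim] by blast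
  have hom: "s \<in> ring_hom R R" if "s \<in> S" for s using S that by auto
  have cl: "s x \<in> carrier R" if "s \<in> S" "x \<in> carrier R" for s x
    using hom that ring_hom_closed by fastforce
  have "card (set Us) < card S" using \<open>\<not> card S \<le> m\<close> card_length[of Us] Us(2) by simp
  then obtain c where c: "c \<in> S \<rightarrow> carrier R" "\<exists>s\<in>S. c s \<noteq> \<zero>"
    "\<forall>u\<in>set Us. (\<Oplus>s\<in>S. c s \<otimes> s u) = \<zero>"
    using exists_nontrivial_solution[of "set Us" S "\<lambda>s. s"] S(1) cl Us(1) by blast
  \<comment> \<open>Any element of \<open>S\<close> serves to name the common values on \<open>E\<close>.\<close>
  then obtain t where t: "t \<in> S" by blast
  have "(\<Oplus>s\<in>S. c s \<otimes> s x) = \<zero>" if "x \<in> Span E Us" for x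
    using that Us(1) c(3)
  proof (induction Us arbitrary: x)
    case Nil
    have "(\<Oplus>s\<in>S. c s \<otimes> s x) = (\<Oplus>s\<in>S. \<zero>)"
    proof (rule finsum_cong')
      fix s assume s: "s \<in> S"
      have "s \<zero> = \<zero>" using ring_hom_zero[OF hom[OF s]] ring_axioms by blast
      then show "c s \<otimes> s x = \<zero>" using Nil c(1) s by (simp add: Pi_def)
    qed auto
    then show ?case by simp
  next
    case (Cons u Us)
    obtain k v where kv: "k \<in> E" "v \<in> Span E Us" "x = k \<otimes> u \<oplus> v"
      using Cons.prems(1) by (auto simp: line_extension_mem_iff)
    have carr: "k \<in> carrier R" "u \<in> carrier R" "v \<in> carrier R"
      using kv Cons.prems subfieldE(3)[OF E] Span_in_carrier[of E Us] by auto
    have "(\<Oplus>s\<in>S. c s \<otimes> s x) = (\<Oplus>s\<in>S. t k \<otimes> (c s \<otimes> s u) \<oplus> c s \<otimes> s v)"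
    proof (rule finsum_cong')
      fix s assume s: "s \<in> S"
      have "s x = t k \<otimes> s u \<oplus> s v"
        using hom[OF s] kv carr agree[OF s t kv(1)] by (simp add: ring_hom_add ring_hom_mult)
      moreover have "c s \<in> carrier R" "t k \<in> carrier R" "s u \<in> carrier R" "s v \<in> carrier R"
        using c s t cl carr by auto
      ultimately show "c s \<otimes> s x = t k \<otimes> (c s \<otimes> s u) \<oplus> c s \<otimes> s v" by simp algebra
    qed (use c(1) cl t carr in \<open>auto simp: Pi_iff\<close>)
    also have "\<dots> = (\<Oplus>s\<in>S. t k \<otimes> (c s \<otimes> s u)) \<oplus> (\<Oplus>s\<in>S. c s \<otimes> s v)"
      by (rule finsum_addf) (use c(1) cl t carr in \<open>auto simp: Pi_iff\<close>)
    also have "(\<Oplus>s\<in>S. t k \<otimes> (c s \<otimes> s u)) = t k \<otimes> (\<Oplus>s\<in>S. c s \<otimes> s u)"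
      by (rule finsum_rdistr[symmetric]) (use S c(1) cl t carr in \<open>auto simp: Pi_iff\<close>)
    finally show ?case
      using Cons.IH[OF kv(2)] Cons.prems cl[OF t carr(1)] by simp
  qed
  then have "\<forall>s\<in>S. c s = \<zero>"
    using ring_homs_independent[OF ring_axioms S c(1)] Us(3) by blast
  with c(2) show False by blast
qed

section \<open>Roots of irreducible polynomials\<close>

text \<open>
  Sort the elements \<open>s\<close> of \<open>G\<close> by the root \<open>s x\<close> of \<open>p\<close>. Those with the same image of \<open>x\<close>
  agree on \<open>E = K(x)\<close>, so there are at most \<open>[L : E]\<close> of them. As \<open>G\<close> has at least \<open>[L : K]\<close>
  elements, \<open>[L : K]\<close> is at most \<open>[L : E]\<close> times the number of roots, while \<open>[L : K] = deg p * [L : E]\<close>.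
\<close>

lemma (in field) degree_le_card_roots:
  assumes K: "subfield K R" and dim: "dimension n K (carrier R)"
    and G: "finite G" "n \<le> card G" "G \<subseteq> ring_hom R R \<inter> extensional (carrier R)"
      "\<forall>s\<in>G. \<forall>k\<in>K. s k = k"
    and p: "p \<in> carrier (K[X])" "pirreducible K p" and root: "is_root p x"
  shows "degree p \<le> card {y. is_root p y}"
proof -
  have x: "x \<in> carrier R" "eval p x = \<zero>" using root by (auto simp: is_root_def)
  have pR: "p \<in> carrier (poly_ring R)" by (rule carrier_polynomial_shell[OF subfieldE(1)[OF K] p(1)])
  have alg: "(algebraic over K) x"
    using algebraicI[of p K x] p x root by (auto simp: is_root_def over_def)
  define E where "E = simple_extension K x"
  have E: "subfield E R"
    unfolding E_def using simple_extension_is_subfield[OF K x(1)] alg by blast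
  have "degree p = degree (Irr K x)"
  proof -
    note Irr = IrrE[OF K x(1) alg]
    have "Irr K x divides\<^bsub>K[X]\<^esub> p"
      using Irr_minimal[OF K x(1) alg p(1) x(2)] pdivides_iff_shell[OF K Irr(1) p(1)] by blast
    then have "Irr K x \<sim>\<^bsub>K[X]\<^esub> p"
      using divides_pirreducible_condition[OF p(2) Irr(1)]
        pirreducibleE(2)[OF subfieldE(1)[OF K] Irr(1,2)] by blast
    then show ?thesis
      using associated_polynomials_imp_same_length[OF subfieldE(1)[OF K] Irr(1) p(1)] by simp
  qed
  then have dimE: "dimension (degree p) K E"
    unfolding E_def using dimension_simple_extension[OF K x(1) alg] by simp
  \<comment> \<open>A spanning list over \<open>K\<close> also spans over the larger field \<open>E\<close>.\<close>
  have "finite_dimension E (carrier R)"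
  proof -
    obtain Us where Us: "set Us \<subseteq> carrier R" "Span K Us = carrier R"
      using exists_base[OF K dim] by blast
    have "K \<subseteq> E" unfolding E_def by (rule simple_extension_incl[OF subfieldE(3)[OF K] x(1)])
    then have "Span K Us \<subseteq> Span E Us"
      using Span_eq_combine_set[OF K Us(1)] Span_eq_combine_set[OF E Us(1)] by blast
    then have "Span E Us = carrier R" using Us Span_in_carrier[OF subfieldE(3)[OF E] Us(1)] by blast
    then show ?thesis using Span_finite_dimension[OF E Us(1)] by simp
  qed
  then obtain m where m: "dimension m E (carrier R)" by blast
  have n: "n = degree p * m"
    using telescopic_base[OF K E dimE m] dimension_is_inj[OF K dim] by blast
  have hom: "s \<in> ring_hom R R" if "s \<in> G" for s using G(3) that by blast
  have s_eval: "s (eval q x) = eval q (s x)" if "s \<in> G" "q \<in> carrier (K[X])" for s q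
  proof -
    interpret s: ring_hom_ring R R s using ring_hom_ringI2[OF ring_axioms ring_axioms hom[OF that(1)]] .
    have "set q \<subseteq> K" using that(2) by (auto simp: polynomial_def simp flip: univ_poly_carrier)
    then have "map s q = q" using G(4) that(1) by (intro map_idI) auto
    then show ?thesis using s.eval_hom[OF subfieldE(1)[OF K] x(1) that(2)] by simp
  qed
  have fibre: "card {s \<in> G. s x = y} \<le> m" for y
  proof (rule card_homs_agreeing_le_degree[OF E m])
    fix s t k assume st: "s \<in> {s \<in> G. s x = y}" "t \<in> {s \<in> G. s x = y}" and "k \<in> E"
    then obtain q where "q \<in> carrier (K[X])" "k = eval q x"
      unfolding E_def simple_extension_as_eval_img[OF subfieldE(3)[OF K] x(1)] by blast
    then show "s k = t k" using s_eval[of s q] s_eval[of t q] st by simp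
  qed (use G in auto)
  have img: "(\<lambda>s. s x) ` G \<subseteq> {y. is_root p y}"
  proof (clarsimp simp: is_root_def)
    fix s assume s: "s \<in> G"
    have "s \<zero> = \<zero>" using ring_hom_zero[OF hom[OF s]] ring_axioms by blast
    then show "s x \<in> carrier R \<and> eval p (s x) = \<zero> \<and> p \<noteq> []"
      using s_eval[OF s p(1)] x ring_hom_closed[OF hom[OF s]] root by (simp add: is_root_def)
  qed
  have "G = (\<Union>y\<in>(\<lambda>s. s x) ` G. {s \<in> G. s x = y})" by blast
  then have "card G \<le> (\<Sum>y\<in>(\<lambda>s. s x) ` G. card {s \<in> G. s x = y})"
    using card_UN_le[of "(\<lambda>s. s x) ` G" "\<lambda>y. {s \<in> G. s x = y}"] G(1) by simp
  also have "\<dots> \<le> card ((\<lambda>s. s x) ` G) * m"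
    using sum_bounded_above[of "(\<lambda>s. s x) ` G", OF fibre] by simp
  also have "\<dots> \<le> card {y. is_root p y} * m"
    using card_mono[OF finite_number_of_roots[OF pR] img] by simp
  finally have "degree p * m \<le> card {y. is_root p y} * m" using G(2) unfolding n by (rule order_trans[rotated])
  moreover have "m \<noteq> 0" using dimension_zero[OF E] m one_not_zero by (metis one_closed singletonD)
  ultimately show ?thesis by (metis mult_le_cancel2 gr0I)
qed

text \<open>
  The multiset of roots has size at most \<open>deg p\<close>, so it is the set of roots.
\<close>

lemma (in field) splitted_simple_if_enough_roots:
  assumes p: "p \<in> carrier (poly_ring R)" and le: "degree p \<le> card {y. is_root p y}"
  shows "splitted p" "alg_mult p x \<le> 1"
proof -
  let ?Z = "{y. is_root p y}"
  have Z: "set_mset (roots p) = ?Z" using roots_mem_iff_is_root[OF p] by blast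
  have sub: "mset_set ?Z \<subseteq># roots p" using mset_set_set_mset_msubset[of "roots p"] Z by simp
  have "size (roots p) \<le> card ?Z" using size_roots_le_degree[OF p] le by simp
  then have eq: "roots p = mset_set ?Z"
    using sub by (metis leD mset_subset_size size_mset_set subset_mset.le_imp_less_or_eq)
  then show "splitted p"
    using le size_roots_le_degree[OF p] by (simp add: splitted_def)
  show "alg_mult p x \<le> 1" unfolding alg_mult_eq_count_roots[OF p] eq by (simp add: count_mset_set')
qed

section \<open>Simple roots and the formal derivative\<close>

text \<open>
  Coefficients are listed from the leading one down. The result is not normalized, since in
  positive characteristic the leading coefficient may vanish.
\<close>

fun (in ring) formal_deriv :: "'a list \<Rightarrow> 'a list" where
  "formal_deriv [] = []"
| "formal_deriv (c # cs) = (if cs = [] then [] else ([length cs] \<cdot> c) # formal_deriv cs)"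

lemma (in ring) length_formal_deriv: "length (formal_deriv p) = length p - 1"
  by (induction p) auto

lemma (in ring) formal_deriv_in_carrier: "set p \<subseteq> carrier R \<Longrightarrow> set (formal_deriv p) \<subseteq> carrier R"
  by (induction p) auto

lemma (in ring_hom_ring) hom_add_pow:
  "a \<in> carrier R \<Longrightarrow> h ([(n::nat)] \<cdot>\<^bsub>R\<^esub> a) = [n] \<cdot>\<^bsub>S\<^esub> h a"
  by (induction n) auto

lemma (in ring_hom_ring) formal_deriv_hom:
  "set p \<subseteq> carrier R \<Longrightarrow> map h (R.formal_deriv p) = S.formal_deriv (map h p)"
  by (induction p) (auto simp: hom_add_pow)

text \<open>
  Horner's step \<open>p X + c\<close> for the derivative: \<open>(p X + c)' = p' X + p\<close>.
\<close>

lemma (in cring) eval_formal_deriv_append: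
  assumes "set p \<subseteq> carrier R" "c \<in> carrier R" "a \<in> carrier R"
  shows "eval (formal_deriv (p @ [c])) a = eval (formal_deriv p) a \<otimes> a \<oplus> eval p a"
  using assms(1)
proof (induction p)
  case Nil
  then show ?case using assms by simp
next
  case (Cons b p)
  then have b: "b \<in> carrier R" and p: "set p \<subseteq> carrier R" by auto
  have cl: "eval p a \<in> carrier R" "eval (formal_deriv p) a \<in> carrier R"
    using eval_in_carrier formal_deriv_in_carrier p assms(3) by auto
  show ?case
  proof (cases "p = []")
    case True
    then show ?thesis using b assms by simp
  next
    case False
    then obtain k where k: "length p = Suc k" by (cases p) auto
    have cl': "[length p] \<cdot> b \<in> carrier R" "a [^] k \<in> carrier R" using b assms by auto
    have len: "length (formal_deriv (p @ [c])) = Suc k" "length (formal_deriv p) = k"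
      using k by (simp_all add: length_formal_deriv)
    have "eval (formal_deriv ((b # p) @ [c])) a
        = ([length p] \<cdot> b \<oplus> b) \<otimes> (a [^] k \<otimes> a) \<oplus> (eval (formal_deriv p) a \<otimes> a \<oplus> eval p a)"
      using Cons.IH[OF p] by (simp add: len)
    also have "\<dots> = ([length p] \<cdot> b \<otimes> a [^] k \<oplus> eval (formal_deriv p) a) \<otimes> a
        \<oplus> (b \<otimes> (a [^] k \<otimes> a) \<oplus> eval p a)"
      using b cl cl' assms(3) by algebra
    also have "\<dots> = eval (formal_deriv (b # p)) a \<otimes> a \<oplus> eval (b # p) a"
      using False by (simp add: len k)
    finally show ?thesis .
  qed
qed

lemma (in domain) append_as_horner_step:
  assumes "p \<in> carrier (poly_ring R)" "c \<in> carrier R"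
  shows "normalize (p @ [c]) = p \<otimes>\<^bsub>poly_ring R\<^esub> X \<oplus>\<^bsub>poly_ring R\<^esub> poly_of_const c"
proof -
  have sp: "set p \<subseteq> carrier R"
    using assms(1) by (auto simp: polynomial_def simp flip: univ_poly_carrier)
  have "p \<otimes>\<^bsub>poly_ring R\<^esub> X \<oplus>\<^bsub>poly_ring R\<^esub> poly_of_const c
      = poly_add (normalize (p @ [\<zero>])) (normalize [c])"
    unfolding univ_poly_mult univ_poly_add poly_mult_var'(2)[OF sp] poly_of_const_def by (rule refl)
  also have "\<dots> = poly_add (p @ [\<zero>]) [c]"
    by (rule poly_add_normalize(3)[symmetric]) (use sp assms in auto)
  also have "\<dots> = normalize (p @ [c])"
    using poly_add_append_replicate[OF sp, of "[c]"] assms by simp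
  finally show ?thesis by simp
qed

text \<open>
  Taylor expansion to first order, \<open>p = p(a) + (X - a) q\<close> with \<open>q(a) = p'(a)\<close>. Both the
  quotient and the derivative follow Horner's scheme, which is an induction on the coefficient list.
\<close>

lemma (in domain) linear_factor_remainder_deriv:
  assumes "p \<in> carrier (poly_ring R)" "a \<in> carrier R"
  shows "\<exists>q \<in> carrier (poly_ring R).
    p = [\<one>, \<ominus> a] \<otimes>\<^bsub>poly_ring R\<^esub> q \<oplus>\<^bsub>poly_ring R\<^esub> poly_of_const (eval p a) \<and>
    eval q a = eval (formal_deriv p) a"
  using assms(1)
proof (induction p rule: rev_induct)
  interpret UP: domain "poly_ring R" using univ_poly_is_domain[OF carrier_is_subring] .
  case Nil
  have b: "[\<one>, \<ominus> a] \<in> carrier (poly_ring R)"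
    using assms(2) by (simp flip: univ_poly_carrier add: polynomial_def)
  have "poly_of_const (eval [] a) = \<zero>\<^bsub>poly_ring R\<^esub>"
    by (simp add: poly_of_const_def univ_poly_zero)
  then show ?case
    using b UP.r_null[OF b] UP.l_zero[OF UP.zero_closed] UP.zero_closed
    by (intro bexI[of _ "[]"]) (auto simp: univ_poly_zero)
next
  interpret UP: domain "poly_ring R" using univ_poly_is_domain[OF carrier_is_subring] .
  let ?P = "poly_ring R" and ?C = poly_of_const
  case (snoc c p)
  have p: "p \<in> carrier ?P" and c: "c \<in> carrier R" and sp: "set p \<subseteq> carrier R"
    using snoc.prems by (auto simp: polynomial_def simp flip: univ_poly_carrier)
  obtain q where q: "q \<in> carrier ?P" "p = [\<one>, \<ominus> a] \<otimes>\<^bsub>?P\<^esub> q \<oplus>\<^bsub>?P\<^esub> ?C (eval p a)"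
    "eval q a = eval (formal_deriv p) a"
    using snoc.IH[OF p] by blast
  interpret H: ring_hom_ring R ?P ?C
    using canonical_embedding_ring_hom[OF carrier_is_subring] by simp
  interpret E: ring_hom_ring ?P R "\<lambda>f. eval f a"
    using eval_ring_hom[OF carrier_is_subring assms(2)] .
  have X: "X \<in> carrier ?P" by (rule var_closed(1)[OF carrier_is_subring])
  have e: "eval p a \<in> carrier R" using eval_in_carrier sp assms(2) by blast
  have b: "[\<one>, \<ominus> a] = X \<ominus>\<^bsub>?P\<^esub> ?C a"
  proof -
    have "[\<one>] \<in> carrier ?P" by (simp flip: univ_poly_carrier add: polynomial_def)
    moreover have "[\<one>] \<otimes>\<^bsub>?P\<^esub> X = X" using UP.l_one[OF X] by (simp add: univ_poly_one)
    moreover have "?C (\<ominus> a) = \<ominus>\<^bsub>?P\<^esub> ?C a" using assms(2) by simp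
    ultimately show ?thesis
      using append_as_horner_step[of "[\<one>]" "\<ominus> a"] assms(2) by (simp add: UP.minus_eq)
  qed
  have pc: "p @ [c] = p \<otimes>\<^bsub>?P\<^esub> X \<oplus>\<^bsub>?P\<^esub> ?C c"
    using append_as_horner_step[OF p c] normalize_polynomial snoc.prems
    by (simp flip: univ_poly_carrier)
  \<comment> \<open>The next partial quotient of synthetic division by \<open>X - a\<close>.\<close>
  define r where "r = q \<otimes>\<^bsub>?P\<^esub> X \<oplus>\<^bsub>?P\<^esub> ?C (eval p a)"
  have r: "r \<in> carrier ?P" unfolding r_def using q X e by simp
  have ev: "eval (p @ [c]) a = eval p a \<otimes> a \<oplus> c"
    using eval_append_aux[OF sp c assms(2)] .
  have "p @ [c] = ((X \<ominus>\<^bsub>?P\<^esub> ?C a) \<otimes>\<^bsub>?P\<^esub> q \<oplus>\<^bsub>?P\<^esub> ?C (eval p a)) \<otimes>\<^bsub>?P\<^esub> X \<oplus>\<^bsub>?P\<^esub> ?C c"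
    unfolding pc using q(2) unfolding b by simp
  also have "\<dots> = (X \<ominus>\<^bsub>?P\<^esub> ?C a) \<otimes>\<^bsub>?P\<^esub> r \<oplus>\<^bsub>?P\<^esub> ((?C (eval p a) \<otimes>\<^bsub>?P\<^esub> ?C a) \<oplus>\<^bsub>?P\<^esub> ?C c)"
    unfolding r_def using q(1) X e H.hom_closed[OF e] H.hom_closed[OF assms(2)] H.hom_closed[OF c]
    by algebra
  also have "(?C (eval p a) \<otimes>\<^bsub>?P\<^esub> ?C a) \<oplus>\<^bsub>?P\<^esub> ?C c = ?C (eval (p @ [c]) a)"
    unfolding ev using e assms(2) c by simp
  finally have "p @ [c] = [\<one>, \<ominus> a] \<otimes>\<^bsub>?P\<^esub> r \<oplus>\<^bsub>?P\<^esub> ?C (eval (p @ [c]) a)"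
    unfolding b .
  moreover have "eval r a = eval (formal_deriv (p @ [c])) a"
  proof -
    have "eval (?C (eval p a)) a = eval p a" unfolding poly_of_const_def using e by simp
    then have "eval r a = eval q a \<otimes> a \<oplus> eval p a"
      unfolding r_def using q X H.hom_closed[OF e] eval_var[OF assms(2)] by simp
    then show ?thesis using eval_formal_deriv_append[OF sp c assms(2)] q(3) by simp
  qed
  ultimately show ?case using r by blast
qed

text \<open>
  In \<open>p = (X - a) q\<close> the value \<open>q(a)\<close> is \<open>p'(a)\<close>, so \<open>X - a\<close> divides \<open>p\<close> twice exactly when
  \<open>p'(a) = 0\<close>.
\<close>

lemma (in domain) simple_root_iff_eval_formal_deriv:
  assumes p: "p \<in> carrier (poly_ring R)" and root: "is_root p a"
  shows "alg_mult p a \<le> 1 \<longleftrightarrow> eval (formal_deriv p) a \<noteq> \<zero>"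
proof -
  interpret UP: domain "poly_ring R" using univ_poly_is_domain[OF carrier_is_subring] .
  let ?P = "poly_ring R" and ?b = "[\<one>, \<ominus> a]"
  have a: "a \<in> carrier R" "eval p a = \<zero>" "p \<noteq> []" using root by (auto simp: is_root_def)
  have b: "?b \<in> carrier ?P" using a by (simp flip: univ_poly_carrier add: polynomial_def)
  have b0: "?b \<noteq> \<zero>\<^bsub>?P\<^esub>" by (simp add: univ_poly_zero)
  have b2: "?b [^]\<^bsub>?P\<^esub> (2::nat) = ?b \<otimes>\<^bsub>?P\<^esub> ?b" using b by (simp add: numeral_2_eq_2)
  obtain q where q: "q \<in> carrier ?P" "p = ?b \<otimes>\<^bsub>?P\<^esub> q \<oplus>\<^bsub>?P\<^esub> poly_of_const (eval p a)"
    "eval q a = eval (formal_deriv p) a"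
    using linear_factor_remainder_deriv[OF p a(1)] by blast
  have pq: "p = ?b \<otimes>\<^bsub>?P\<^esub> q"
  proof -
    have "poly_of_const (eval p a) = \<zero>\<^bsub>?P\<^esub>" using a(2) by (simp add: poly_of_const_def univ_poly_zero)
    then show ?thesis using q(2) q(1) b by simp
  qed
  have q0: "q \<noteq> []" using pq a(3) b UP.r_null by (auto simp: univ_poly_zero)
  have eq: "2 \<le> alg_mult p a \<longleftrightarrow> ?b [^]\<^bsub>?P\<^esub> (2::nat) pdivides p"
    using le_alg_mult_imp_pdivides[OF a(1) p] alg_multE(2)[OF a(1) p a(3)] by blast
  also have "\<dots> \<longleftrightarrow> ?b pdivides q"
  proof
    assume "?b [^]\<^bsub>?P\<^esub> (2::nat) pdivides p"
    then obtain r where r: "r \<in> carrier ?P" "?b \<otimes>\<^bsub>?P\<^esub> q = ?b \<otimes>\<^bsub>?P\<^esub> (?b \<otimes>\<^bsub>?P\<^esub> r)"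
      unfolding pdivides_def factor_def b2 pq[symmetric] using b UP.m_assoc by auto
    then have "q = ?b \<otimes>\<^bsub>?P\<^esub> r" using UP.m_lcancel[OF b0 b q(1)] b by simp
    then show "?b pdivides q" using r by (auto simp: pdivides_def factor_def)
  next
    assume "?b pdivides q"
    then obtain r where "r \<in> carrier ?P" "q = ?b \<otimes>\<^bsub>?P\<^esub> r" by (auto simp: pdivides_def factor_def)
    then have "r \<in> carrier ?P" "p = ?b \<otimes>\<^bsub>?P\<^esub> ?b \<otimes>\<^bsub>?P\<^esub> r" using pq b UP.m_assoc by auto
    then show "?b [^]\<^bsub>?P\<^esub> (2::nat) pdivides p" unfolding pdivides_def factor_def b2 by blast
  qed
  also have "\<dots> \<longleftrightarrow> eval q a = \<zero>"
    using pdivides_imp_is_root[OF q0 a(1)] is_root_imp_pdivides[OF q(1), of a] q0 a(1)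
    by (auto simp: is_root_def)
  finally show ?thesis using q(3) by auto
qed

text \<open>
  The right-hand side mentions neither \<open>S\<close> nor \<open>a\<close>: whether a root of an irreducible polynomial
  is simple can be tested in any extension field. This transfers simplicity from \<open>L\<close> to the algebraic
  closure of \<open>K\<close> without embedding one into the other. If \<open>p'\<close> vanishes at \<open>a\<close>, then it lies in the
  ideal of the polynomials over \<open>F\<close> that vanish at \<open>a\<close>, which is generated by \<open>p\<close>; being of smaller
  degree, \<open>p'\<close> is zero.
\<close>

lemma simple_root_iff_formal_deriv_nonzero:
  assumes F: "field F" and S: "field S" and h: "h \<in> ring_hom F S"
    and p: "p \<in> carrier (poly_ring F)" "pirreducible\<^bsub>F\<^esub> (carrier F) p"
    and root: "ring.is_root S (map h p) a"
  shows "ring.alg_mult S (map h p) a \<le> 1 \<longleftrightarrow> ring.normalize F (ring.formal_deriv F p) \<noteq> []"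
proof -
  interpret F: field F by (rule F)
  interpret S: field S by (rule S)
  interpret H: ring_hom_ring F S h
    using ring_hom_ringI2[OF F.ring_axioms S.ring_axioms h] .
  let ?P = "poly_ring F"
  interpret UP: principal_domain ?P using F.univ_poly_is_principal[OF F.carrier_is_subfield] .
  define d where "d = F.normalize (F.formal_deriv p)"
  have a: "a \<in> carrier S" "S.eval (map h p) a = \<zero>\<^bsub>S\<^esub>" using root by (auto simp: S.is_root_def)
  have sp: "set p \<subseteq> carrier F" using p by (auto simp: polynomial_def simp flip: univ_poly_carrier)
  have sd: "set (F.formal_deriv p) \<subseteq> carrier F" by (rule F.formal_deriv_in_carrier[OF sp])
  have d: "d \<in> carrier ?P"
    using F.normalize_gives_polynomial[OF sd] by (simp add: d_def univ_poly_carrier)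
  have hp: "map h p \<in> carrier (poly_ring S)" using polynomial_hom[OF h F S p(1)] .
  \<comment> \<open>Normalizing strips leading zeros, which do not affect values.\<close>
  have evd: "S.eval (map h d) a = S.eval (S.formal_deriv (map h p)) a"
  proof -
    have "F.formal_deriv p = replicate (length (F.formal_deriv p) - length d) \<zero>\<^bsub>F\<^esub> @ d"
      unfolding d_def by (rule F.normalize_trick)
    then have "S.formal_deriv (map h p)
        = replicate (length (F.formal_deriv p) - length d) \<zero>\<^bsub>S\<^esub> @ map h d"
      by (metis H.formal_deriv_hom[OF sp] H.hom_zero map_append map_replicate)
    moreover have "set (map h d) \<subseteq> carrier S"
      using d by (auto simp: polynomial_def simp flip: univ_poly_carrier)
    ultimately show ?thesis using S.eval_replicate[OF _ a(1)] by simp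
  qed
  have "S.eval (map h d) a = \<zero>\<^bsub>S\<^esub> \<longleftrightarrow> d = []"
  proof
    assume d0: "S.eval (map h d) a = \<zero>\<^bsub>S\<^esub>"
    show "d = []"
    proof (rule ccontr)
      assume "d \<noteq> []"
      have hom: "ring_hom_ring ?P S (\<lambda>f. S.eval (map h f) a)"
      proof (rule ring_hom_ringI)
        fix f g assume fg: "f \<in> carrier ?P" "g \<in> carrier ?P"
        then have sfg: "set f \<subseteq> carrier F" "set g \<subseteq> carrier F"
          by (auto simp: polynomial_def simp flip: univ_poly_carrier)
        then have sh: "set (map h f) \<subseteq> carrier S" "set (map h g) \<subseteq> carrier S" by auto
        show "S.eval (map h (f \<otimes>\<^bsub>?P\<^esub> g)) a = S.eval (map h f) a \<otimes>\<^bsub>S\<^esub> S.eval (map h g) a"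
        proof -
          have "set (map h (F.poly_mult f g)) \<subseteq> carrier S"
            using F.poly_mult_in_carrier[OF sfg] by auto
          then have "S.eval (map h (f \<otimes>\<^bsub>?P\<^esub> g)) a = S.eval (S.poly_mult (map h f) (map h g)) a"
            unfolding H.poly_mult_hom'[OF sfg, symmetric] univ_poly_mult
            by (rule S.eval_normalize[OF _ a(1), symmetric])
          then show ?thesis using S.eval_poly_mult[OF sh a(1)] by simp
        qed
        show "S.eval (map h (f \<oplus>\<^bsub>?P\<^esub> g)) a = S.eval (map h f) a \<oplus>\<^bsub>S\<^esub> S.eval (map h g) a"
        proof -
          have "set (map h (F.poly_add f g)) \<subseteq> carrier S"
            using F.poly_add_in_carrier[OF sfg] by auto
          then have "S.eval (map h (f \<oplus>\<^bsub>?P\<^esub> g)) a = S.eval (S.poly_add (map h f) (map h g)) a"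
            unfolding H.poly_add_hom'[OF sfg, symmetric] univ_poly_add
            by (rule S.eval_normalize[OF _ a(1), symmetric])
          then show ?thesis using S.eval_poly_add[OF sh a(1)] by simp
        qed
      next
        fix f assume "f \<in> carrier ?P"
        then have "set (map h f) \<subseteq> carrier S"
          by (auto simp: polynomial_def simp flip: univ_poly_carrier)
        then show "S.eval (map h f) a \<in> carrier S" using S.eval_in_carrier a(1) by blast
      qed (use a(1) in \<open>simp_all add: UP.ring_axioms S.ring_axioms univ_poly_one\<close>)
      define I where "I = a_kernel ?P S (\<lambda>f. S.eval (map h f) a)"
      have I: "ideal I ?P" unfolding I_def by (rule ring_hom_ring.kernel_is_ideal[OF hom])
      have "p \<in> I" "d \<in> I" "\<one>\<^bsub>?P\<^esub> \<notin> I"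
        using p d a d0 ring_hom_one[OF ring_hom_ring.homh[OF hom]] by (auto simp: I_def a_kernel_def')
      \<comment> \<open>The ideal generated by an irreducible polynomial is maximal, and \<open>I\<close> is proper.\<close>
      then have "PIdl\<^bsub>?P\<^esub> p = I"
        using maximalideal.I_maximal[OF UP.irreducible_imp_maximalideal[OF p] I]
          UP.cgenideal_minimal[OF I] ideal.Icarr[OF I] UP.one_closed by blast
      then have "p divides\<^bsub>?P\<^esub> d"
        using UP.to_contain_is_to_divide[OF p(1) d] UP.cgenideal_minimal[OF I \<open>d \<in> I\<close>] by simp
      then have "length p - 1 \<le> length d - 1"
        using F.pdivides_imp_degree_le[OF F.carrier_is_subring p(1) d \<open>d \<noteq> []\<close>]
        by (simp add: pdivides_def)
      moreover have "length d \<le> length p - 1"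
        using F.normalize_length_le[of "F.formal_deriv p"] by (simp add: d_def F.length_formal_deriv)
      moreover have "length p - 1 \<ge> 1"
        using F.pirreducible_degree[OF F.carrier_is_subfield p] .
      ultimately show False by linarith
    qed
  qed simp
  then show ?thesis
    using S.simple_root_iff_eval_formal_deriv[OF hp root] evd d_def by simp
qed

section \<open>The extension is Galois\<close>

theorem proposition3p7:
  fixes L :: "('a, 'b) ring_scheme" and K :: "'a set"
  assumes "field L" and "subfield K L"
    and "noetherian_ring (poly_composite L K)"
    and "card_eq_degree (carrier (galois_group L K)) L K"
    and "\<And>M :: ('a + nat) list ring. field M \<Longrightarrow> invariant_in L K M"
  shows "noetherian_ring (poly_composite L K) \<longleftrightarrow> galois_extension L K"
proof -
  interpret L: field L by fact
  note K = \<open>subfield K L\<close>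
  let ?G = "carrier (galois_group L K)"
  obtain n where n: "L.dimension n K (carrier L)"
    using L.noetherian_composite_imp_finite_dimension[OF K assms(3)] by blast
  obtain B where B: "vs_basis L K B" "?G \<approx> B" using assms(4) by (auto simp: card_eq_degree_def)
  note finB = L.card_vs_basis[OF K n B(1)]
  have G: "finite ?G" "n \<le> card ?G"
    using eqpoll_finite_iff[OF B(2)] finB eqpoll_iff_card[of ?G B] B(2) by auto
  have Gsub: "?G \<subseteq> ring_hom L L \<inter> extensional (carrier L)" "\<forall>s\<in>?G. \<forall>k\<in>K. s k = k"
    by (auto simp: galois_group_def ring_iso_def)
  have roots: "L.splitted p" "L.alg_mult p y \<le> 1"
    if p: "p \<in> carrier (K[X]\<^bsub>L\<^esub>)" "pirreducible\<^bsub>L\<^esub> K p" and root: "L.is_root p x" for p x y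
    using L.splitted_simple_if_enough_roots[OF L.carrier_polynomial_shell[OF subfieldE(1)[OF K] p(1)]
        L.degree_le_card_roots[OF K n G Gsub p root]] by blast+
  have alg: "(L.algebraic over K) x" if "x \<in> carrier L" for x
    using L.finite_dimension_imp_algebraic[OF K L.carrier_is_subring L.finite_dimensionI[OF n] that] .
  have "separable_extension L K"
    unfolding separable_extension_def Let_def
  proof (intro ballI)
    let ?F = "L\<lparr>carrier := K\<rparr>"
    interpret F: field ?F using L.subfield_iff(2)[OF K] .
    fix x a assume x: "x \<in> carrier L" and a: "a \<in> carrier F.alg_closure"
    interpret C: algebraic_closure F.alg_closure "F.indexed_const ` carrier ?F"
      by (rule F.alg_closureE(1))
    note Irr = L.IrrE[OF K x alg[OF x]]
    let ?p = "L.Irr K x"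
    have p: "?p \<in> carrier (poly_ring ?F)" "pirreducible\<^bsub>?F\<^esub> (carrier ?F) ?p"
      using Irr(1,2) L.univ_poly_consistent[OF subfieldE(1)[OF K]] by simp_all
    have root: "L.is_root ?p x"
      using Irr x L.pirreducibleE(1)[OF subfieldE(1)[OF K] Irr(1,2)] by (auto simp: L.is_root_def)
    have id: "id \<in> ring_hom ?F L"
      using subfieldE(3)[OF K] by (auto simp: ring_hom_def)
    \<comment> \<open>Tested at the simple root \<open>x\<close> in \<open>L\<close>, then used at \<open>a\<close> in the algebraic closure.\<close>
    have "F.normalize (F.formal_deriv ?p) \<noteq> []"
      using simple_root_iff_formal_deriv_nonzero[OF F.field_axioms L.field_axioms id p, of x] root
        roots(2)[OF Irr(1,2) root, of x] by simp
    moreover have "C.is_root (F.\<sigma> ?p) a" if "C.alg_mult (F.\<sigma> ?p) a > 0"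
      using C.alg_mult_gt_zero_iff_is_root polynomial_hom[OF F.alg_closureE(2) F.field_axioms C.field_axioms p(1)] that
      by (simp add: F.\<sigma>_def)
    ultimately show "C.alg_mult (F.\<sigma> ?p) a \<le> 1"
      using simple_root_iff_formal_deriv_nonzero[OF F.field_axioms C.field_axioms F.alg_closureE(2) p, of a]
      by (fastforce simp: F.\<sigma>_def)
  qed
  moreover have "normal_extension L K" using roots(1) by (auto simp: normal_extension_def)
  moreover have "algebraic_extension L K" using alg by (simp add: algebraic_extension_def)
  ultimately show ?thesis using assms(3) by (simp add: galois_extension_def)
qed

end
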